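(* Let $\mathscr{E}=\{\eta_i,\rho_i\}_{i=1}^n$ be a two-qubit state ensemble (i.e. an ensemble of states on $\mathbb{C}^2\otimes\mathbb{C}^2$), let $\rho_0=\sum_{i=1}^n\eta_i\rho_i$, let $q\in\mathbb{R}$ and $j\in\{1,\ldots,n\}$. Then $$\mathcal{Q}_j(\mathscr{E})=q<\mathcal{C}_j(\mathscr{E})$$ if and only if $q\rho_0-\eta_j\rho_j$ is a weakly-optimal entanglement witness. Moreover, if $\rho_0$ is not full rank, then $\mathcal{C}_j(\mathscr{E})$ is achievable locally, that is, $\mathcal{L}_j(\mathscr{E})=\mathcal{C}_j(\mathscr{E})$.
   Context: Let $\mathscr{H}=\mathbb{C}^2\otimes\mathbb{C}^2$. $\mathbb{H}$ is the set of Hermitian operators on $\mathscr{H}$, and $\mathbb{H}_+\subseteq\mathbb{H}$ is the set of positive-semidefinite ones. A state is $\rho\in\mathbb{H}_+$ with $\operatorname{Tr}\rho=1$. An ensemble $\{\eta_i,\rho_i\}_{i=1}^n$ consists of states $\rho_i$ with nonzero probabilities $\eta_i$ (so $\eta_i>0$, $\sum_i\eta_i=1$). An operator $E\in\mathbb{H}_+$ is separable if $E=\sum_l p_l\,\sigma_l^{(1)}\otimes\sigma_l^{(2)}$ with $p_l\geqslant 0$ and $\sigma_l^{(k)}$ states on $\mathbb{C}^2$; $\mathbb{SEP}$ is the set of all separable operators. A separable state is an element of $\mathbb{SEP}$ of trace $1$. An operator $E\in\mathbb{H}$ is block positive if $\operatorname{Tr}(EF)\geqslant0$ for all $F\in\mathbb{SEP}$;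 $\mathbb{SEP}^*$ is the set of all block-positive operators. An entanglement witness is an element of $\mathbb{SEP}^*\setminus\mathbb{H}_+$; an entanglement witness $W$ is weakly optimal if there is a separable state $\sigma$ with $\operatorname{Tr}(\sigma W)=0$. A measurement is a family $\mathscr{M}=\{M_i\}_{i=0}^n\subseteq\mathbb{H}_+$ with $\sum_iM_i=\mathbb{1}$. It is an LOCC measurement if it can be realized by local operations and classical communication, i.e. by a protocol in which the parties perform local quantum operations and measurements on their own subsystems (possibly using randomness and depending on previously communicated messages), exchange classical messages, and determine the final outcome from the classical record. When $\operatorname{Tr}(\rho_0M_j)\neq0$, the confidence to identify $\rho_j$ is $\Pr(\rho_j|M_j)=\dfrac{\eta_j\operatorname{Tr}(\rho_jM_j)}{\operatorname{Tr}(\rho_0M_j)}$. $\mathcal{C}_j(\mathscr{E})$ (resp. $\mathcal{L}_j(\mathscr{E})$) is the maximum of $\Pr(\rho_j|M_j)$ over all measurements (resp. all LOCC measurements) with $\operatorname{Tr}(\rho_0M_j)\neq0$. $\mathcal{Q}_j(\mathscr{E})=\min\{q\in\mathbb{R}\mid q\rho_0-\eta_j\rho_j\in\mathbb{SEP}^*\}$.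
   Formalization: L_j is taken as the supremum of the confidence over LOCC measurements instead of the maximum, because for some ensembles with ρ_0 not full rank the LOCC maximum is not attained; so C_j is approached, not necessarily achieved, locally. *)

theory Defs
  imports "HOL-Analysis.Analysis"
begin

text \<open>Operators on \<open>\<complex>\<^sup>n\<close> are square matrices over the index type. The space
  \<open>\<complex>\<^sup>2 \<otimes> \<complex>\<^sup>2\<close> is \<open>complex^(2 \<times> 2)\<close>: the pair \<open>(a, b)\<close> indexes the product
  basis vector \<open>e\<^sub>a \<otimes> e\<^sub>b\<close>.\<close>

type_synonym qubit_op = "complex^2^2"
type_synonym two_qubit_op = "complex^(2 \<times> 2)^(2 \<times> 2)"

definition adj :: "complex^'n^'m \<Rightarrow> complex^'m^'n"
  where "adj A = (\<chi> i j. cnj (A $ j $ i))"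

definition hermitian :: "(complex^'n^'n) set"
  where "hermitian = {A. adj A = A}"

text \<open>The quadratic form of a Hermitian matrix is real, so only its real part is tested.\<close>

definition psd :: "(complex^'n^'n) set"
  where "psd = {A \<in> hermitian. \<forall>v. 0 \<le> Re (\<Sum>i\<in>UNIV. cnj (v $ i) * (A *v v) $ i)}"

definition states :: "(complex^'n^'n) set"
  where "states = {A \<in> psd. trace A = 1}"

definition tensor :: "complex^'a^'a \<Rightarrow> complex^'b^'b \<Rightarrow> complex^('a \<times> 'b)^('a \<times> 'b)"
  where "tensor A B = (\<chi> x y. A $ fst x $ fst y * B $ snd x $ snd y)"

definition SEP :: "two_qubit_op set"
  where "SEP = {E \<in> psd. \<exists>(k::nat) (p :: nat \<Rightarrow> real) (\<sigma> :: nat \<Rightarrow> qubit_op) (\<tau> :: nat \<Rightarrow> qubit_op).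
    (\<forall>l<k. 0 \<le> p l \<and> \<sigma> l \<in> states \<and> \<tau> l \<in> states) \<and>
    E = (\<Sum>l<k. p l *\<^sub>R tensor (\<sigma> l) (\<tau> l))}"

definition separable_states :: "two_qubit_op set"
  where "separable_states = {\<sigma> \<in> SEP. trace \<sigma> = 1}"

text \<open>The trace of a product of two Hermitian matrices is real; this is why \<open>Re\<close> loses
  nothing here and in the confidence below.\<close>

definition block_positive :: "two_qubit_op set"
  where "block_positive = {E \<in> hermitian. \<forall>F\<in>SEP. 0 \<le> Re (trace (E ** F))}"

definition entanglement_witness :: "two_qubit_op \<Rightarrow> bool"
  where "entanglement_witness W \<longleftrightarrow> W \<in> block_positive - psd"

definition weakly_optimal_witness :: "two_qubit_op \<Rightarrow> bool"
  where "weakly_optimal_witness W \<longleftrightarrow>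
    entanglement_witness W \<and> (\<exists>\<sigma>\<in>separable_states. trace (\<sigma> ** W) = 0)"

definition ensemble :: "nat \<Rightarrow> (nat \<Rightarrow> real) \<Rightarrow> (nat \<Rightarrow> two_qubit_op) \<Rightarrow> bool"
  where "ensemble n \<eta> \<rho> \<longleftrightarrow>
    (\<forall>i\<in>{1..n}. \<rho> i \<in> states \<and> 0 < \<eta> i) \<and> (\<Sum>i=1..n. \<eta> i) = 1"

definition average_state :: "nat \<Rightarrow> (nat \<Rightarrow> real) \<Rightarrow> (nat \<Rightarrow> two_qubit_op) \<Rightarrow> two_qubit_op"
  where "average_state n \<eta> \<rho> = (\<Sum>i=1..n. \<eta> i *\<^sub>R \<rho> i)"

definition measurement :: "nat \<Rightarrow> (nat \<Rightarrow> two_qubit_op) \<Rightarrow> bool"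
  where "measurement n M \<longleftrightarrow> (\<forall>i\<le>n. M i \<in> psd) \<and> (\<Sum>i\<le>n. M i) = mat 1"

text \<open>In a protocol the dimensions of the local systems may change (a party may adjoin or
  discard ancillas), so inside protocols matrices are functions on natural-number indices:
  \<open>K l a\<close> for \<open>l < d'\<close> and \<open>a < d\<close> represents a map from \<open>\<complex>\<^sup>d\<close> to the space of
  dimension \<open>d'\<close>, and a bipartite operator has entries \<open>N (a, b) (a', b')\<close>. Entries outside
  the index range are irrelevant.

  A local quantum instrument on a \<open>d\<close>-dimensional system has \<open>c\<close> recorded outcomes; on
  outcome \<open>m < c\<close> the state is transformed by the completely positive map with Kraus
  operators \<open>K m r\<close>, \<open>r < s m\<close>, into a system of dimension \<open>d' m\<close>. The index \<open>r\<close> is not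
  recorded.\<close>

definition instrument ::
  "nat \<Rightarrow> nat \<Rightarrow> (nat \<Rightarrow> nat) \<Rightarrow> (nat \<Rightarrow> nat) \<Rightarrow> (nat \<Rightarrow> nat \<Rightarrow> nat \<Rightarrow> nat \<Rightarrow> complex) \<Rightarrow> bool"
  where "instrument d c s d' K \<longleftrightarrow>
    (\<forall>a<d. \<forall>a'<d. (\<Sum>m<c. \<Sum>r<s m. \<Sum>l<d' m. cnj (K m r l a) * K m r l a') =
      (if a = a' then 1 else 0))"

text \<open>\<open>(K \<otimes> 1)\<^sup>\<dagger> N (K \<otimes> 1)\<close> and \<open>(1 \<otimes> K)\<^sup>\<dagger> N (1 \<otimes> K)\<close>.\<close>

definition pull_fst ::
  "nat \<Rightarrow> (nat \<Rightarrow> nat \<Rightarrow> complex) \<Rightarrow> (nat \<times> nat \<Rightarrow> nat \<times> nat \<Rightarrow> complex) \<Rightarrow>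
    (nat \<times> nat \<Rightarrow> nat \<times> nat \<Rightarrow> complex)"
  where "pull_fst d' K N = (\<lambda>(a, b) (a', b').
    \<Sum>l<d'. \<Sum>l'<d'. cnj (K l a) * N (l, b) (l', b') * K l' a')"

definition pull_snd ::
  "nat \<Rightarrow> (nat \<Rightarrow> nat \<Rightarrow> complex) \<Rightarrow> (nat \<times> nat \<Rightarrow> nat \<times> nat \<Rightarrow> complex) \<Rightarrow>
    (nat \<times> nat \<Rightarrow> nat \<times> nat \<Rightarrow> complex)"
  where "pull_snd d' K N = (\<lambda>(a, b) (a', b').
    \<Sum>l<d'. \<Sum>l'<d'. cnj (K l b) * N (a, l) (a', l') * K l' b')"

text \<open>\<open>locc dA dB E\<close>: some finite protocol on local systems of dimensions \<open>dA\<close> and \<open>dB\<close> has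
  the effect \<open>E i\<close> for each final outcome \<open>i\<close>. The protocol is a tree, read from the root:
  either it stops with a final outcome, or one party applies a local instrument, announces
  the recorded outcome \<open>m\<close>, and the parties go on with the protocol selected by \<open>m\<close>.
  The position in the tree is the classical record. Randomness is the
  instrument with Kraus operators \<open>sqrt (p m)\<close> times the identity. The effects are those of
  the continuation in the Heisenberg picture.\<close>

inductive locc :: "nat \<Rightarrow> nat \<Rightarrow> (nat \<Rightarrow> nat \<times> nat \<Rightarrow> nat \<times> nat \<Rightarrow> complex) \<Rightarrow> bool" where
  stop: "locc dA dB (\<lambda>i x y. if i = k \<and> x = y then 1 else 0)"
| first_party: "instrument dA c s d' K \<Longrightarrow> (\<And>m. m < c \<Longrightarrow> locc (d' m) dB (N m)) \<Longrightarrow>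
    locc dA dB (\<lambda>i x y. \<Sum>m<c. \<Sum>r<s m. pull_fst (d' m) (K m r) (N m i) x y)"
| second_party: "instrument dB c s d' K \<Longrightarrow> (\<And>m. m < c \<Longrightarrow> locc dA (d' m) (N m)) \<Longrightarrow>
    locc dA dB (\<lambda>i x y. \<Sum>m<c. \<Sum>r<s m. pull_snd (d' m) (K m r) (N m i) x y)"

text \<open>\<open>of_nat\<close> identifies the indices \<open>0\<close> and \<open>1\<close> with the two elements of the type \<open>2\<close>.\<close>

definition locc_measurement :: "nat \<Rightarrow> (nat \<Rightarrow> two_qubit_op) \<Rightarrow> bool"
  where "locc_measurement n M \<longleftrightarrow> measurement n M \<and>
    (\<exists>E. locc 2 2 E \<and>
      (\<forall>i\<le>n. \<forall>a<2. \<forall>b<2. \<forall>a'<2. \<forall>b'<2.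
        M i $ (of_nat a, of_nat b) $ (of_nat a', of_nat b') = E i (a, b) (a', b')))"

definition confidence ::
  "nat \<Rightarrow> (nat \<Rightarrow> real) \<Rightarrow> (nat \<Rightarrow> two_qubit_op) \<Rightarrow> nat \<Rightarrow> (nat \<Rightarrow> two_qubit_op) \<Rightarrow> real"
  where "confidence n \<eta> \<rho> j M =
    \<eta> j * Re (trace (\<rho> j ** M j)) / Re (trace (average_state n \<eta> \<rho> ** M j))"

definition max_confidence ::
  "nat \<Rightarrow> (nat \<Rightarrow> real) \<Rightarrow> (nat \<Rightarrow> two_qubit_op) \<Rightarrow> nat \<Rightarrow> real"
  where "max_confidence n \<eta> \<rho> j = (GREATEST c. \<exists>M. measurement n M \<and>
    trace (average_state n \<eta> \<rho> ** M j) \<noteq> 0 \<and> c = confidence n \<eta> \<rho> j M)"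

text \<open>A supremum, because the maximum over LOCC measurements need not be attained. With
  \<open>\<psi>\<^sub>\<plusminus> = (e\<^sub>0 \<otimes> e\<^sub>1 \<plusminus> e\<^sub>1 \<otimes> e\<^sub>0) / sqrt 2\<close>, \<open>\<eta>\<^sub>1 = 1/3\<close>, \<open>\<eta>\<^sub>2 = 2/3\<close>, let \<open>\<rho>\<^sub>1\<close> be the
  projection onto \<open>\<psi>\<^sub>+\<close> and \<open>\<rho>\<^sub>2\<close> half the projection onto the span of \<open>\<psi>\<^sub>-\<close> and
  \<open>e\<^sub>1 \<otimes> e\<^sub>1\<close>. The only product vectors orthogonal to the support of \<open>\<rho>\<^sub>2\<close> are the
  multiples of \<open>e\<^sub>0 \<otimes> e\<^sub>0\<close>, which the average state annihilates. So no LOCC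
  measurement has confidence 1 for \<open>\<rho>\<^sub>1\<close>, but the product effects onto
  \<open>(e\<^sub>0 + t e\<^sub>1) \<otimes> (e\<^sub>0 + t e\<^sub>1)\<close> have confidences that tend to 1 as \<open>t\<close> tends to 0.\<close>

definition locc_confidence ::
  "nat \<Rightarrow> (nat \<Rightarrow> real) \<Rightarrow> (nat \<Rightarrow> two_qubit_op) \<Rightarrow> nat \<Rightarrow> real"
  where "locc_confidence n \<eta> \<rho> j = Sup {confidence n \<eta> \<rho> j M | M. locc_measurement n M \<and>
    trace (average_state n \<eta> \<rho> ** M j) \<noteq> 0}"

definition witness_bound ::
  "nat \<Rightarrow> (nat \<Rightarrow> real) \<Rightarrow> (nat \<Rightarrow> two_qubit_op) \<Rightarrow> nat \<Rightarrow> real"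
  where "witness_bound n \<eta> \<rho> j =
    (LEAST q. q *\<^sub>R average_state n \<eta> \<rho> - \<eta> j *\<^sub>R \<rho> j \<in> block_positive)"

end

theory Submission
  imports Defs
begin

text \<open>Write \<open>W\<^sub>q = q \<rho>\<^sub>0 - \<eta>\<^sub>j \<rho>\<^sub>j\<close>. The confidence is a quotient of quadratic forms, so the maximal
  confidence is the least \<open>q\<close> with \<open>W\<^sub>q\<close> positive semidefinite, attained by compactness on the
  orthogonal complement of \<open>ker \<rho>\<^sub>0\<close>. If \<open>q\<close> is the least value with \<open>W\<^sub>q\<close> block positive, compactness
  of the product unit vectors gives a product state annihilating \<open>W\<^sub>q\<close>.

  The part special to two qubits is that a block positive \<open>W\<close> with a kernel vector \<open>k \<noteq> 0\<close> is
  positive semidefinite: for generic \<open>v\<close> some \<open>v + c k\<close> is a product vector, and \<open>W\<close> has the same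
  quadratic form at \<open>v\<close> and at \<open>v + c k\<close>. Since \<open>ker \<rho>\<^sub>0 \<subseteq> ker W\<^sub>q\<close>, the two bounds agree when
  \<open>\<rho>\<^sub>0\<close> is singular. A separable state annihilating \<open>W\<^sub>q\<close> for \<open>q\<close> above the least value would
  annihilate \<open>\<rho>\<^sub>0\<close> as well and so put us in this case. For the local confidence, local projective
  measurements onto product vectors bound \<open>W\<^sub>q\<close> on all product vectors.\<close>

section \<open>Hermitian matrices and quadratic forms\<close>

definition outer :: "complex^'n \<Rightarrow> complex^'n^'n"
  where "outer v = (\<chi> i j. v $ i * cnj (v $ j))"

text \<open>The inner product on complex vectors is the real one, the real part of the Hermitian
  product. Hermitian forms are real, so nothing is lost, and real orthogonality and continuity apply
  directly.\<close>

lemma inner_cvec: "x \<bullet> y = Re (\<Sum>i\<in>UNIV. cnj (x $ i) * y $ i)" for x y :: "complex^'n"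
  by (simp add: inner_vec_def inner_complex_def)

lemma psd_iff: "A \<in> psd \<longleftrightarrow> A \<in> hermitian \<and> (\<forall>v. 0 \<le> v \<bullet> (A *v v))"
  by (simp add: psd_def inner_cvec)

lemma hermitian_nth: "A \<in> hermitian \<Longrightarrow> cnj (A $ i $ j) = A $ j $ i"
  by (auto simp: hermitian_def adj_def vec_eq_iff)

lemma hermitianI: "(\<And>i j. cnj (A $ i $ j) = A $ j $ i) \<Longrightarrow> A \<in> hermitian"
  by (auto simp: hermitian_def adj_def vec_eq_iff)

lemma subspace_hermitian: "subspace (hermitian :: (complex^'n^'n) set)"
  unfolding subspace_def by (auto intro!: hermitianI simp: hermitian_nth)

lemma hermitian_inner:
  assumes "A \<in> hermitian"
  shows "x \<bullet> (A *v y) = (A *v x) \<bullet> y"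
proof -
  have "(\<Sum>i\<in>UNIV. cnj (x $ i) * (A *v y) $ i) =
      (\<Sum>i\<in>UNIV. \<Sum>j\<in>UNIV. cnj (x $ i) * A $ i $ j * y $ j)"
    by (simp add: matrix_vector_mult_def sum_distrib_left mult.assoc)
  also have "\<dots> = (\<Sum>j\<in>UNIV. \<Sum>i\<in>UNIV. cnj (x $ i) * A $ i $ j * y $ j)"
    by (rule sum.swap)
  also have "\<dots> = (\<Sum>j\<in>UNIV. cnj ((A *v x) $ j) * y $ j)"
    by (simp add: matrix_vector_mult_def sum_distrib_right sum_distrib_left hermitian_nth[OF assms] mult_ac)
  finally show ?thesis by (simp add: inner_cvec)
qed

lemma scaleR_mult_vec: "(c *\<^sub>R A) *v x = c *\<^sub>R (A *v x)" for A :: "complex^'n^'m"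
  by (simp add: vec_eq_iff matrix_vector_mult_def scaleR_sum_right)

lemma linear_mult_vec: "linear ((*v) A)" for A :: "complex^'n^'m"
proof (rule linearI)
  show "A *v (x + y) = A *v x + A *v y" for x y by (rule matrix_vector_right_distrib)
  show "A *v (c *\<^sub>R x) = c *\<^sub>R (A *v x)" for c x
    by (simp add: vec_eq_iff matrix_vector_mult_def scaleR_sum_right)
qed

lemma mult_vec_scaleR: "A *v (c *\<^sub>R x) = c *\<^sub>R (A *v x)" for A :: "complex^'n^'m"
  by (rule linear_scale[OF linear_mult_vec])

lemma continuous_on_mult_vec [continuous_intros]:
  "continuous_on S f \<Longrightarrow> continuous_on S (\<lambda>x. A *v f x)" for A :: "complex^'n^'m"
  by (rule bounded_linear.continuous_on) (simp add: linear_conv_bounded_linear[symmetric] linear_mult_vec)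

lemma outer_mult_vec: "outer v *v x = (\<Sum>i\<in>UNIV. cnj (v $ i) * x $ i) *s v"
  by (simp add: vec_eq_iff outer_def matrix_vector_mult_def sum_distrib_left mult_ac)

lemma inner_outer: "x \<bullet> (outer v *v x) = (norm (\<Sum>i\<in>UNIV. cnj (v $ i) * x $ i))\<^sup>2"
proof -
  define s where "s = (\<Sum>i\<in>UNIV. cnj (v $ i) * x $ i)"
  have "cnj s = (\<Sum>i\<in>UNIV. v $ i * cnj (x $ i))" by (simp add: s_def)
  moreover have "outer v *v x = s *s v" by (simp add: outer_mult_vec s_def)
  ultimately have "(\<Sum>i\<in>UNIV. cnj (x $ i) * (outer v *v x) $ i) = s * cnj s"
    by (simp add: sum_distrib_left mult_ac)
  then show ?thesis by (simp add: inner_cvec s_def[symmetric] complex_norm_square[symmetric])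
qed

lemma outer_psd: "outer v \<in> psd"
  by (auto simp: psd_iff inner_outer intro!: hermitianI) (simp add: outer_def)

lemma psd_hermitian: "A \<in> psd \<Longrightarrow> A \<in> hermitian"
  by (simp add: psd_iff)

lemma psd_add: "A \<in> psd \<Longrightarrow> B \<in> psd \<Longrightarrow> A + B \<in> psd"
  by (simp add: psd_iff matrix_vector_mult_add_rdistrib inner_add_right
      subspace_add[OF subspace_hermitian])

lemma psd_scaleR: "A \<in> psd \<Longrightarrow> 0 \<le> c \<Longrightarrow> c *\<^sub>R A \<in> psd"
  by (simp add: psd_iff scaleR_mult_vec subspace_scale[OF subspace_hermitian])

lemma psd_0: "0 \<in> psd"
  by (simp add: psd_iff subspace_0[OF subspace_hermitian])

lemma psd_sum: "(\<And>i. i \<in> I \<Longrightarrow> A i \<in> psd) \<Longrightarrow> (\<Sum>i\<in>I. A i) \<in> psd"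
  by (induction I rule: infinite_finite_induct) (simp_all add: psd_0 psd_add)

lemma inner_add_mult_vec:
  assumes "A \<in> hermitian"
  shows "(x + y) \<bullet> (A *v (x + y)) = x \<bullet> (A *v x) + 2 * (x \<bullet> (A *v y)) + y \<bullet> (A *v y)"
  using hermitian_inner[OF assms, of y x]
  by (simp add: matrix_vector_right_distrib inner_add_left inner_add_right inner_commute)

text \<open>If \<open>A *v x\<close> were nonzero, moving \<open>x\<close> slightly against it would
  change the form at first order and make it negative.\<close>

lemma psd_kernel:
  assumes "A \<in> psd" "x \<bullet> (A *v x) = 0"
  shows "A *v x = 0"
proof (rule ccontr)
  assume nz: "A *v x \<noteq> 0"
  define y where "y = A *v x"
  define s where "s = y \<bullet> y"
  define b where "b = y \<bullet> (A *v y)"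
  have s: "s > 0" using nz by (simp add: y_def s_def)
  have b: "b \<ge> 0" using assms by (simp add: psd_iff b_def)
  \<comment> \<open>The quadratic in \<open>t\<close> has its minimum at \<open>- s / b\<close>; the
    denominator \<open>b + 1\<close> is positive even for \<open>b = 0\<close> and still gives a
    negative value.\<close>
  define t where "t = - s / (b + 1)"
  have herm: "A \<in> hermitian" using assms by (simp add: psd_iff)
  have "0 \<le> (x + t *\<^sub>R y) \<bullet> (A *v (x + t *\<^sub>R y))" using assms by (simp add: psd_iff)
  also have "\<dots> = 2 * t * s + t\<^sup>2 * b"
    using assms(2) hermitian_inner[OF herm, of x y] 
    by (simp add: mult_vec_scaleR inner_add_mult_vec[OF herm] s_def b_def y_def power2_eq_square)
  also have "\<dots> = - (s\<^sup>2 * (b + 2)) / (b + 1)\<^sup>2"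
  proof -
    have s_eq: "s = - t * (b + 1)" using b by (simp add: t_def field_simps)
    have "2 * t * s + t\<^sup>2 * b = - (t\<^sup>2 * (b + 2))"
      by (subst s_eq) (simp add: power2_eq_square algebra_simps)
    then show ?thesis by (simp add: t_def power_divide)
  qed
  also have "\<dots> < 0" using s b by (simp add: divide_neg_pos)
  finally show False by simp
qed

lemma inner_kernel_add:
  assumes "A \<in> hermitian" "A *v k = 0"
  shows "(x + c *s k) \<bullet> (A *v (x + c *s k)) = x \<bullet> (A *v x)"
proof -
  have "A *v (c *s k) = 0" using assms(2) by (simp add: vector_scalar_commute)
  then show ?thesis by (simp add: inner_add_mult_vec[OF assms(1)])
qed

lemma mult_vec_axis: "A *v axis k 1 = column k A" for A :: "complex^'n^'m"
  by (simp add: vec_eq_iff matrix_vector_mult_def axis_def column_def if_distrib cong: if_cong)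

lemma inner_axis_mult_vec: "axis k 1 \<bullet> (A *v axis k 1) = Re (A $ k $ k)" for A :: "complex^'n^'n"
  by (simp add: mult_vec_axis inner_axis' column_def inner_complex_def)

text \<open>Schur complements: subtracting the rank-one matrix \<open>A e\<^sub>k (A e\<^sub>k)\<^sup>\<dagger> / A\<^sub>k\<^sub>k\<close> clears the \<open>k\<close>-th
  row and column and preserves positivity.\<close>

lemma psd_induct [consumes 1, case_names zero add]:
  assumes "A \<in> psd" "P 0" and add: "\<And>B v. P B \<Longrightarrow> P (B + outer v)"
  shows "P A"
  using assms(1)
proof (induction "card {i. A $ i $ i \<noteq> 0}" arbitrary: A rule: less_induct)
  case less
  have herm: "A \<in> hermitian" using less.prems by (simp add: psd_iff)
  have im: "Im (A $ i $ i) = 0" for i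
    using arg_cong[OF hermitian_nth[OF herm, of i i], of Im] by simp
  \<comment> \<open>A zero diagonal entry is a zero of the form at a basis vector, so the whole
    column vanishes. Hence \<open>A = 0\<close> once the diagonal is zero.\<close>
  have row0: "A $ i $ k = 0" if "A $ k $ k = 0" for i k
  proof -
    have "A *v axis k 1 = 0"
      using psd_kernel[OF less.prems, of "axis k 1"] that by (simp add: inner_axis_mult_vec)
    then show ?thesis by (simp add: mult_vec_axis column_def vec_eq_iff)
  qed
  show ?case
  proof (cases "\<exists>k. A $ k $ k \<noteq> 0")
    case False
    then have "A = 0" using row0 by (simp add: vec_eq_iff)
    then show ?thesis using assms(2) by simp
  next
    case True
    then obtain k where k: "A $ k $ k \<noteq> 0" by blast
    define d where "d = Re (A $ k $ k)"
    have Akk: "A $ k $ k = of_real d" using im by (simp add: d_def complex_eq_iff)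
    have "0 \<le> d" using less.prems inner_axis_mult_vec[of k A] by (metis psd_iff d_def)
    then have d: "d > 0" using k Akk by (cases "d = 0") auto
    define v where "v = (1 / sqrt d) *\<^sub>R column k A"
    define B where "B = A - outer v"
    have Bij: "B $ i $ j = A $ i $ j - A $ i $ k * A $ k $ j / of_real d" for i j
    proof -
      have "v $ i * cnj (v $ j) = (1 / sqrt d * (1 / sqrt d)) *\<^sub>R (A $ i $ k * A $ k $ j)"
        by (simp add: v_def column_def hermitian_nth[OF herm])
      also have "1 / sqrt d * (1 / sqrt d) = 1 / d" using d by simp
      finally show ?thesis by (simp add: B_def outer_def scaleR_conv_of_real)
    qed
    have hB: "B \<in> hermitian"
      by (rule hermitianI) (simp add: Bij hermitian_nth[OF herm])
    have row: "(B *v axis k 1) = 0"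
      using d by (simp add: mult_vec_axis column_def vec_eq_iff Bij Akk)
    have "0 \<le> x \<bullet> (B *v x)" for x
    proof -
      \<comment> \<open>This multiple of \<open>axis k 1\<close> makes \<open>y\<close> orthogonal
        to \<open>v\<close>, so \<open>B\<close> and \<open>A\<close> have the same form at
        \<open>y\<close>. Since \<open>axis k 1\<close> lies in the kernel of \<open>B\<close>, the
        form of \<open>B\<close> at \<open>x\<close> equals that at \<open>y\<close>.\<close>
      define c where "c = - (A *v x) $ k / of_real d"
      define y where "y = x + c *s axis k 1"
      have "(A *v y) $ k = (A *v x) $ k + c * A $ k $ k"
        by (simp add: y_def matrix_vector_right_distrib vector_scalar_commute mult_vec_axis column_def)
      then have "(A *v y) $ k = 0" using d by (simp add: c_def Akk)
      then have "(\<Sum>i\<in>UNIV. cnj (v $ i) * y $ i) = 0"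
        using d by (simp add: v_def column_def hermitian_nth[OF herm] matrix_vector_mult_def
            mult.assoc flip: scaleR_sum_right)
      then have "y \<bullet> (outer v *v y) = 0" by (simp add: inner_outer)
      then have "y \<bullet> (B *v y) = y \<bullet> (A *v y)"
        by (simp add: B_def matrix_vector_mult_diff_rdistrib inner_diff_right)
      also have "\<dots> \<ge> 0" using less.prems by (simp add: psd_iff)
      finally show ?thesis by (simp add: y_def inner_kernel_add[OF hB row])
    qed
    then have pB: "B \<in> psd" using hB by (simp add: psd_iff)
    \<comment> \<open>Zero diagonal entries stay zero because their rows vanish, and the
      \<open>k\<close>-th entry is cleared, so the induction measure drops.\<close>
    have "{i. B $ i $ i \<noteq> 0} \<subseteq> {i. A $ i $ i \<noteq> 0} - {k}"
      using d row0 by (auto simp: Bij Akk)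
    then have "card {i. B $ i $ i \<noteq> 0} < card {i. A $ i $ i \<noteq> 0}"
      using k by (intro psubset_card_mono) auto
    from add[OF less.hyps[OF this pB], of v] show ?thesis by (simp add: B_def)
  qed
qed

section \<open>Traces of products of positive semidefinite matrices\<close>

lemma trace_outer:
  assumes "A \<in> hermitian"
  shows "trace (A ** outer v) = of_real (v \<bullet> (A *v v))"
proof -
  have eq: "trace (A ** outer v) = (\<Sum>i\<in>UNIV. cnj (v $ i) * (A *v v) $ i)"
    by (simp add: trace_def matrix_matrix_mult_def outer_def matrix_vector_mult_def
        sum_distrib_left mult_ac)
  \<comment> \<open>Conjugating and swapping the summations returns the same sum, so it is real; the
    inner product alone only sees its real part.\<close>
  have "cnj (\<Sum>i\<in>UNIV. cnj (v $ i) * (A *v v) $ i) = (\<Sum>i\<in>UNIV. \<Sum>j\<in>UNIV. v $ i * A $ j $ i * cnj (v $ j))"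
    by (simp add: matrix_vector_mult_def sum_distrib_left hermitian_nth[OF assms] mult_ac)
  also have "\<dots> = (\<Sum>j\<in>UNIV. \<Sum>i\<in>UNIV. v $ i * A $ j $ i * cnj (v $ j))"
    by (rule sum.swap)
  also have "\<dots> = (\<Sum>i\<in>UNIV. cnj (v $ i) * (A *v v) $ i)"
    by (simp add: matrix_vector_mult_def sum_distrib_left mult_ac)
  finally have "Im (\<Sum>i\<in>UNIV. cnj (v $ i) * (A *v v) $ i) = 0"
    by (metis Im_complex_of_real complex_cnj_cancel_iff cnj.simps(2) neg_equal_zero)
  then show ?thesis unfolding eq by (simp add: inner_cvec complex_eq_iff)
qed

lemma trace_scaleR: "trace (c *\<^sub>R A) = c *\<^sub>R trace A" for A :: "complex^'n^'n"
  by (simp add: trace_def scaleR_sum_right)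

lemma matrix_diff_ldistrib: "A ** (B - C) = A ** B - A ** C" for A B C :: "complex^'n^'n"
  by (simp add: matrix_matrix_mult_def vec_eq_iff right_diff_distrib sum_subtractf)

lemma trace_mult_scaleR: "trace (A ** (c *\<^sub>R B)) = c *\<^sub>R trace (A ** B)" for A B :: "complex^'n^'n"
  by (simp add: trace_def matrix_matrix_mult_def scaleR_sum_right)

text \<open>Writing \<open>B\<close> as a sum of rank-one matrices turns the trace into a sum of
  values of the form of \<open>A\<close>.\<close>

lemma trace_mult_psd:
  assumes "A \<in> psd" "B \<in> psd"
  shows "0 \<le> Re (trace (A ** B))" "Im (trace (A ** B)) = 0"
  using assms(2)
  by (induction rule: psd_induct)
    (use assms(1) in \<open>simp_all add: matrix_add_ldistrib trace_add trace_outer psd_iff trace_def[of 0]\<close>)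

text \<open>A sum of nonnegative values of the form of \<open>A\<close> vanishes only if every
  rank-one piece of \<open>B\<close> comes from a kernel vector of \<open>A\<close>. With a trivial
  kernel, \<open>B\<close> would be zero.\<close>

lemma trace_mult_psd_eq_0:
  assumes "A \<in> psd" "B \<in> psd" "trace (A ** B) = 0" "B \<noteq> 0"
  shows "\<exists>v. v \<noteq> 0 \<and> A *v v = 0"
proof (rule ccontr)
  assume "\<nexists>v. v \<noteq> 0 \<and> A *v v = 0"
  then have inj: "v = 0" if "A *v v = 0" for v using that by blast
  \<comment> \<open>Membership in \<open>psd\<close> is carried along because it makes the trace
    with the partial sum nonnegative, so that the two summands vanish separately.\<close>
  have "B \<in> psd \<and> (trace (A ** B) = 0 \<longrightarrow> B = 0)"
    using assms(2)
  proof (induction rule: psd_induct)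
    case zero
    then show ?case by (simp add: psd_0)
  next
    case (add B v)
    have "B + outer v = 0" if tr: "trace (A ** (B + outer v)) = 0"
    proof -
      have "trace (A ** B) + of_real (v \<bullet> (A *v v)) = 0"
        using tr by (simp add: matrix_add_ldistrib trace_add trace_outer psd_hermitian[OF assms(1)])
      moreover have "0 \<le> v \<bullet> (A *v v)" using assms(1) by (simp add: psd_iff)
      moreover note trace_mult_psd[OF assms(1), of B] add
      ultimately have "trace (A ** B) = 0" "v \<bullet> (A *v v) = 0"
        by (auto simp: complex_eq_iff)
      then show ?thesis
        using add inj psd_kernel[OF assms(1), of v] by (auto simp: outer_def vec_eq_iff)
    qed
    then show ?case using add by (simp add: psd_add outer_psd)
  qed
  then show False using assms by simp
qed

text \<open>A trivial kernel gives a left inverse, so the rows span the whole space and the row rank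
  is full.\<close>

lemma kernel_if_rank_deficient:
  fixes A :: "complex^'n^'n"
  assumes "rank A \<noteq> CARD('n)"
  obtains v where "v \<noteq> 0" "A *v v = 0"
proof (rule ccontr)
  assume "\<not> thesis"
  then have "\<exists>B. B ** A = mat 1" using matrix_left_invertible_ker[of A] that by blast
  then have "vec.span (rows A) = UNIV" by (simp add: matrix_left_invertible_span_rows_gen)
  then have "vec.dim (rows A) = CARD('n)" by (metis vec.dim_span vec.dim_UNIV vec.dimension_def card_cart_basis vec_dim_card)
  then show False using assms by (simp add: row_rank_def_gen)
qed

section \<open>Product vectors and block positivity\<close>

definition tens :: "complex^'a \<Rightarrow> complex^'b \<Rightarrow> complex^('a \<times> 'b)"
  where "tens a b = (\<chi> x. a $ fst x * b $ snd x)"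

lemma outer_tens: "outer (tens a b) = tensor (outer a) (outer b)"
  by (simp add: outer_def tens_def tensor_def vec_eq_iff)

lemma tens_scaleR: "tens (r *\<^sub>R a) (s *\<^sub>R b) = (r * s) *\<^sub>R tens a b"
  by (simp add: tens_def vec_eq_iff)

lemma inner_scaleR_mult_vec: "(r *\<^sub>R x) \<bullet> (A *v (r *\<^sub>R x)) = r\<^sup>2 * (x \<bullet> (A *v x))"
  for A :: "complex^'n^'n"
  by (simp add: mult_vec_scaleR power2_eq_square)

lemma tensor_add_left: "tensor (A + A') B = tensor A B + tensor A' B"
  and tensor_add_right: "tensor A (B + B') = tensor A B + tensor A B'"
  and tensor_0_left: "tensor 0 B = 0"
  and tensor_0_right: "tensor A 0 = 0"
  by (simp_all add: tensor_def vec_eq_iff algebra_simps)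

lemma outer_state:
  assumes "norm v = 1"
  shows "outer v \<in> states"
proof -
  have "trace (outer v) = (\<Sum>i\<in>UNIV. of_real ((norm (v $ i))\<^sup>2))"
    by (simp add: trace_def outer_def complex_norm_square[symmetric])
  also have "\<dots> = of_real ((norm v)\<^sup>2)"
    by (simp add: norm_vec_def L2_set_def sum_nonneg)
  finally show ?thesis using assms by (simp add: states_def outer_psd)
qed

lemma norm_tens: "norm (tens a b) = norm a * norm b"
proof -
  have "(\<Sum>x\<in>UNIV. (norm (a $ fst x * b $ snd x))\<^sup>2) = (\<Sum>i\<in>UNIV. (norm (a $ i))\<^sup>2) * (\<Sum>j\<in>UNIV. (norm (b $ j))\<^sup>2)"
    by (simp add: sum_product sum.cartesian_product norm_mult power_mult_distrib case_prod_unfold)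
  then show ?thesis by (simp add: norm_vec_def L2_set_def tens_def real_sqrt_mult)
qed

lemma outer_tens_SEP:
  assumes "norm a = 1" "norm b = 1"
  shows "outer (tens a b) \<in> SEP"
  unfolding SEP_def
  by (rule CollectI, rule conjI, rule outer_psd, rule exI[of _ 1], rule exI[of _ "\<lambda>_. 1"],
      rule exI[of _ "\<lambda>_. outer a"], rule exI[of _ "\<lambda>_. outer b"])
    (simp add: outer_tens outer_state assms)

text \<open>By homogeneity. Unit factors are what states and compactness arguments supply; arbitrary
  factors are what the determinant argument produces.\<close>

lemma inner_tens_nonneg_if_unit:
  assumes "\<And>a b. norm a = 1 \<Longrightarrow> norm b = 1 \<Longrightarrow> 0 \<le> tens a b \<bullet> (W *v tens a b)"
  shows "0 \<le> tens a b \<bullet> (W *v tens a b)"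
proof (cases "a = 0 \<or> b = 0")
  case True
  then have "tens a b = 0" by (auto simp: tens_def vec_eq_iff)
  then show ?thesis by simp
next
  case False
  then have "tens a b = (norm a * norm b) *\<^sub>R tens (a /\<^sub>R norm a) (b /\<^sub>R norm b)"
    by (simp add: tens_scaleR field_simps)
  then show ?thesis
    using assms[of "a /\<^sub>R norm a" "b /\<^sub>R norm b"] False
    by (metis inner_scaleR_mult_vec mult_nonneg_nonneg zero_le_power2 norm_sgn sgn_div_norm)
qed

text \<open>Unit product vectors give separable rank-one operators. Conversely, splitting both
  tensor factors into rank-one pieces reduces the trace with a separable operator to values of the
  form at product vectors.\<close>

lemma block_positive_iff:
  "W \<in> block_positive \<longleftrightarrow> W \<in> hermitian \<and> (\<forall>a b. 0 \<le> tens a b \<bullet> (W *v tens a b))"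
proof (intro iffI conjI allI; (elim conjE)?)
  assume W: "W \<in> block_positive"
  then show h: "W \<in> hermitian" by (simp add: block_positive_def)
  show "0 \<le> tens a b \<bullet> (W *v tens a b)" for a b
  proof (rule inner_tens_nonneg_if_unit)
    fix a b :: "complex^2"
    assume "norm a = 1" "norm b = 1"
    then have "0 \<le> Re (trace (W ** outer (tens a b)))"
      using W outer_tens_SEP by (auto simp: block_positive_def)
    then show "0 \<le> tens a b \<bullet> (W *v tens a b)" by (simp add: trace_outer[OF h])
  qed
next
  assume h: "W \<in> hermitian" and pos: "\<forall>a b. 0 \<le> tens a b \<bullet> (W *v tens a b)"
  have t: "0 \<le> Re (trace (W ** tensor \<sigma> \<tau>))" if "\<sigma> \<in> psd" "\<tau> \<in> psd" for \<sigma> \<tau>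
    using that(1)
  proof (induction rule: psd_induct)
    case zero
    then show ?case by (simp add: tensor_0_left trace_def)
  next
    case (add B a)
    have "0 \<le> Re (trace (W ** tensor (outer a) \<tau>))"
      using that(2)
      by (induction rule: psd_induct)
        (use pos in \<open>simp_all add: tensor_0_right tensor_add_right matrix_add_ldistrib trace_add
          trace_outer[OF h] trace_def[of 0] flip: outer_tens\<close>)
    then show ?case using add by (simp add: tensor_add_left matrix_add_ldistrib trace_add)
  qed
  have "0 \<le> Re (trace (W ** (\<Sum>l<k. p l *\<^sub>R tensor (\<sigma> l) (\<tau> l))))"
    if "\<forall>l<k. 0 \<le> p l \<and> \<sigma> l \<in> states \<and> \<tau> l \<in> states"
    for k :: nat and p and \<sigma> \<tau> :: "nat \<Rightarrow> qubit_op"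
    using that
    by (induction k)
      (auto simp: matrix_add_ldistrib trace_add trace_mult_scaleR trace_def[of 0] states_def
        intro!: add_nonneg_nonneg mult_nonneg_nonneg t)
  then show "W \<in> block_positive" using h by (auto simp: block_positive_def SEP_def)
qed

section \<open>Two qubits: product vectors modulo a kernel vector\<close>

lemma sum_UNIV_2x2: "(\<Sum>x\<in>UNIV. f x) = f (1,1) + f (1,2) + f (2,1) + f (2,2)"
  for f :: "2 \<times> 2 \<Rightarrow> 'a::comm_monoid_add"
proof -
  have "(\<Sum>x\<in>UNIV. f x) = (\<Sum>i\<in>UNIV. \<Sum>j\<in>UNIV. f (i, j))" by (simp add: sum.cartesian_product)
  then show ?thesis by (simp add: sum_2 add_ac)
qed

text \<open>A 2 by 2 matrix of determinant zero has rank at most one. A nonzero entry in the first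
  row selects a column of which the other is a multiple; if the first row is zero, the second row is
  the factor.\<close>

lemma tens_exists:
  fixes v :: "complex^(2 \<times> 2)"
  assumes "v $ (1, 1) * v $ (2, 2) = v $ (1, 2) * v $ (2, 1)"
  shows "\<exists>a b. v = tens a b"
proof -
  have eqI: "v = tens a b" if "v $ (1,1) = a $ 1 * b $ 1" "v $ (1,2) = a $ 1 * b $ 2"
    "v $ (2,1) = a $ 2 * b $ 1" "v $ (2,2) = a $ 2 * b $ 2" for a b
    using that by (simp add: tens_def vec_eq_iff split_paired_all forall_2)
  consider "v $ (1,1) \<noteq> 0" | "v $ (1,1) = 0" "v $ (1,2) \<noteq> 0" | "v $ (1,1) = 0" "v $ (1,2) = 0"
    by blast
  then show ?thesis
  proof cases
    case 1
    have "v = tens (vector [v $ (1,1), v $ (2,1)]) (vector [1, v $ (1,2) / v $ (1,1)])"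
      by (rule eqI) (use 1 assms in \<open>simp_all add: field_simps\<close>)
    then show ?thesis by blast
  next
    case 2
    have "v = tens (vector [v $ (1,2), v $ (2,2)]) (vector [0, 1])"
      by (rule eqI) (use 2 assms in simp_all)
    then show ?thesis by blast
  next
    case 3
    have "v = tens (vector [0, 1]) (vector [v $ (2,1), v $ (2,2)])"
      by (rule eqI) (use 3 in simp_all)
    then show ?thesis by blast
  qed
qed

text \<open>The case \<alpha> = 0 is needed because the leading coefficient will be the determinant
  of \<open>k\<close>, which vanishes when \<open>k\<close> is itself a product.\<close>

lemma complex_quadratic_root:
  fixes \<alpha> \<beta> \<gamma> :: complex
  assumes "\<alpha> \<noteq> 0 \<or> \<beta> \<noteq> 0"
  shows "\<exists>c. \<alpha> * c\<^sup>2 + \<beta> * c + \<gamma> = 0"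
proof (cases "\<alpha> = 0")
  case True
  then show ?thesis using assms by (intro exI[of _ "- \<gamma> / \<beta>"]) simp
next
  case False
  define s where "s = csqrt (\<beta>\<^sup>2 - 4 * \<alpha> * \<gamma>)"
  have s: "s\<^sup>2 = \<beta>\<^sup>2 - 4 * \<alpha> * \<gamma>" by (simp add: s_def)
  have eq: "\<alpha> * ((s - \<beta>) / (2 * \<alpha>))\<^sup>2 + \<beta> * ((s - \<beta>) / (2 * \<alpha>)) + \<gamma> = (s\<^sup>2 - (\<beta>\<^sup>2 - 4 * \<alpha> * \<gamma>)) / (4 * \<alpha>)"
    using False by (simp add: power2_eq_square field_simps)
  show ?thesis by (rule exI, rule trans[OF eq]) (simp add: s)
qed

text \<open>A vector \<open>v\<close>, seen as a \<open>2 \<times> 2\<close> matrix, is a product iff its determinant vanishes, and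
  \<open>c \<mapsto> det (v + c k)\<close> is a polynomial of degree at most 2. It is nonconstant for \<open>v\<close> in a dense
  set, so it then has a root.\<close>

lemma tens_modulo_dense:
  fixes k v :: "complex^(2 \<times> 2)"
  assumes "k \<noteq> 0"
  shows "v \<in> closure {tens a b + c *s k | a b c. True}"
proof -
  \<comment> \<open>\<open>D v\<close> is the coefficient of \<open>c\<close> in the determinant of
    \<open>v + c *s k\<close>.\<close>
  define D where "D v = k $ (1,1) * v $ (2,2) + v $ (1,1) * k $ (2,2) - k $ (1,2) * v $ (2,1)
      - v $ (1,2) * k $ (2,1)" for v :: "complex^(2 \<times> 2)"
  have gen: "v \<in> {tens a b + c *s k | a b c. True}" if nz: "D v \<noteq> 0" for v
  proof -
    obtain c where "(k $ (1,1) * k $ (2,2) - k $ (1,2) * k $ (2,1)) * c\<^sup>2 + D v * c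
        + (v $ (1,1) * v $ (2,2) - v $ (1,2) * v $ (2,1)) = 0"
      using complex_quadratic_root[OF disjI2[OF nz]] by blast
    then obtain a b where "v + c *s k = tens a b"
      using tens_exists[of "v + c *s k"] by (auto simp: D_def power2_eq_square algebra_simps)
    then have "v = tens a b + (- c) *s k"
      by (metis add_diff_cancel_right' diff_conv_add_uminus vector_smult_lneg)
    then show ?thesis by blast
  qed
  show ?thesis
  proof (cases "D v = 0")
    case False
    then show ?thesis using gen closure_subset by blast
  next
    case True
    \<comment> \<open>The entries of \<open>w\<close> are the conjugated coefficients of the linear
      form \<open>D\<close>, so \<open>D w\<close> is the squared norm of \<open>k\<close>. Small
      multiples of \<open>w\<close> therefore move \<open>v\<close> off the zero set of
      \<open>D\<close>.\<close>
    define w :: "complex^(2 \<times> 2)" where "w = (\<chi> x. if x = (1,1) then cnj (k $ (2,2))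
      else if x = (2,2) then cnj (k $ (1,1)) else if x = (1,2) then - cnj (k $ (2,1)) else - cnj (k $ (1,2)))"
    have "D w = of_real ((norm k)\<^sup>2)"
      by (simp add: D_def w_def norm_vec_def L2_set_def sum_nonneg sum_UNIV_2x2 complex_norm_square
          del: of_real_power)
    also have "\<dots> \<noteq> 0" using assms by simp
    finally have w: "D w \<noteq> 0" .
    have mem: "v + (1 / real (Suc n)) *\<^sub>R w \<in> {tens a b + c *s k | a b c. True}" for n
    proof (rule gen)
      have "D (v + (1 / real (Suc n)) *\<^sub>R w) = D v + (1 / real (Suc n)) *\<^sub>R D w"
        by (simp add: D_def algebra_simps scaleR_add_right scaleR_diff_right)
      then show "D (v + (1 / real (Suc n)) *\<^sub>R w) \<noteq> 0" using True w by simp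
    qed
    have lim: "(\<lambda>n. v + (1 / real (Suc n)) *\<^sub>R w) \<longlonglongrightarrow> v + 0 *\<^sub>R w"
      by (intro tendsto_intros LIMSEQ_Suc lim_1_over_n)
    show ?thesis
      unfolding closure_sequential using mem lim[unfolded scaleR_zero_left add_0_right]
      by (intro exI[of _ "\<lambda>n. v + (1 / real (Suc n)) *\<^sub>R w"] conjI allI)
  qed
qed

text \<open>Nonnegativity of the form is a closed condition, so it extends from the dense set of
  product vectors modulo \<open>k\<close> to every vector.\<close>

lemma block_positive_singular_psd:
  assumes "W \<in> block_positive" "W *v k = 0" "k \<noteq> 0"
  shows "W \<in> psd"
proof -
  have h: "W \<in> hermitian" using assms by (simp add: block_positive_def)
  have "closure {tens a b + c *s k | a b c. True} \<subseteq> {v. 0 \<le> v \<bullet> (W *v v)}"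
  proof (rule closure_minimal)
    show "{tens a b + c *s k | a b c. True} \<subseteq> {v. 0 \<le> v \<bullet> (W *v v)}"
      using assms(1) by (auto simp: inner_kernel_add[OF h assms(2)] block_positive_iff)
    show "closed {v. 0 \<le> v \<bullet> (W *v v)}"
      by (intro closed_Collect_le continuous_intros)
  qed
  then show ?thesis using tens_modulo_dense[OF assms(3)] h by (auto simp: psd_iff)
qed

section \<open>Projective measurements\<close>

text \<open>Outcome 0 is the inconclusive one and absorbs the complement of the projection.\<close>

definition proj_effects :: "nat \<Rightarrow> complex^'n \<Rightarrow> nat \<Rightarrow> complex^'n^'n"
  where "proj_effects j v i = (if i = j then outer v else if i = 0 then mat 1 - outer v else 0)"

lemma norm_smult: "norm (c *s v) = norm c * norm v" for v :: "complex^'n"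
proof -
  have "(\<Sum>i\<in>UNIV. (norm (c * v $ i))\<^sup>2) = (norm c)\<^sup>2 * (\<Sum>i\<in>UNIV. (norm (v $ i))\<^sup>2)"
    by (simp add: norm_mult power_mult_distrib sum_distrib_left)
  then show ?thesis by (simp add: norm_vec_def L2_set_def real_sqrt_mult)
qed

text \<open>Cauchy-Schwarz for \<open>x\<close> and its projection bounds the squared length of the
  projection by that length times the norm of \<open>x\<close>.\<close>

lemma mat_1_minus_outer_psd:
  fixes v :: "complex^'n"
  assumes "norm v = 1"
  shows "mat 1 - outer v \<in> psd"
proof -
  have "mat 1 \<in> (hermitian :: (complex^'n^'n) set)" by (rule hermitianI) (simp add: mat_def)
  then have h: "mat 1 - outer v \<in> hermitian"
    by (intro subspace_diff[OF subspace_hermitian] psd_hermitian[OF outer_psd])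
  have "x \<bullet> (outer v *v x) \<le> x \<bullet> x" for x
  proof -
    define s where "s = norm (\<Sum>i\<in>UNIV. cnj (v $ i) * x $ i)"
    have "s\<^sup>2 = x \<bullet> (outer v *v x)" by (simp add: inner_outer s_def)
    also have "\<dots> \<le> norm x * s"
      using norm_cauchy_schwarz[of x "outer v *v x"] assms by (simp add: outer_mult_vec norm_smult s_def)
    finally have "s \<le> norm x" by (cases "s = 0") (auto simp: power2_eq_square s_def)
    then have "s\<^sup>2 \<le> (norm x)\<^sup>2" by (intro power_mono) (simp_all add: s_def)
    then show ?thesis by (simp add: inner_outer s_def power2_norm_eq_inner)
  qed
  then show ?thesis using h by (simp add: psd_iff matrix_vector_mult_diff_rdistrib inner_diff_right)
qed

lemma measurement_proj_effects:
  assumes "norm v = 1" "j \<in> {1..n}"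
  shows "measurement n (proj_effects j v)"
proof -
  have "proj_effects j v = (\<lambda>i. (if i = j then outer v else 0) + (if i = 0 then mat 1 - outer v else 0))"
    using assms(2) by (auto simp: proj_effects_def)
  then have "(\<Sum>i\<le>n. proj_effects j v i) = mat 1"
    using assms(2) by (simp add: sum.distrib)
  then show ?thesis
    using assms(1) by (simp add: measurement_def proj_effects_def outer_psd mat_1_minus_outer_psd psd_0)
qed

text \<open>The completeness relation of an orthonormal basis starting with \<open>a\<close>, in the
  shape that \<open>instrument\<close> asks for.\<close>

lemma qubit_basis:
  fixes a :: "complex^2"
  assumes "norm a = 1"
  obtains \<alpha> :: "nat \<Rightarrow> nat \<Rightarrow> complex" where "\<And>x. \<alpha> 0 x = a $ of_nat x"
    "\<And>x y. x < 2 \<Longrightarrow> y < 2 \<Longrightarrow> (\<Sum>m<2. \<alpha> m x * cnj (\<alpha> m y)) = (if x = y then 1 else 0)"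
proof -
  define \<alpha> where "\<alpha> m x = (if m = (0::nat) then a $ of_nat x else if x = (0::nat) then - cnj (a $ 1) else cnj (a $ 0))" for m x
  have "(\<Sum>i\<in>UNIV. (norm (a $ i))\<^sup>2) = 1"
    using assms by (simp add: norm_vec_def L2_set_def)
  \<comment> \<open>Sums over the type \<open>2\<close> run over 1 and 2, whereas
    \<open>of_nat\<close> produces the indices 0 and 1.\<close>
  moreover have "(2::2) = 0" by simp
  ultimately have "(norm (a $ 0))\<^sup>2 + (norm (a $ 1))\<^sup>2 = 1"
    by (metis sum_2 add.commute)
  then have n: "a $ 0 * cnj (a $ 0) + a $ 1 * cnj (a $ 1) = 1"
    by (metis complex_norm_square of_real_1 of_real_add)
  have "(\<Sum>m<2. \<alpha> m x * cnj (\<alpha> m y)) = (if x = y then 1 else 0)" if "x < 2" "y < 2" for x y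
  proof -
    have "x = 0 \<or> x = 1" "y = 0 \<or> y = 1" using that by auto
    then show ?thesis
      using n by (elim disjE) (simp_all add: \<alpha>_def numeral_2_eq_2 algebra_simps)
  qed
  then show thesis by (intro that[of \<alpha>]) (simp_all add: \<alpha>_def)
qed

text \<open>Each party measures in a basis containing its own factor. The final outcome is
  \<open>j\<close> when both find that factor and 0 otherwise.\<close>

lemma locc_measurement_proj_effects:
  assumes "norm a = 1" "norm b = 1" "j \<in> {1..n}"
  shows "locc_measurement n (proj_effects j (tens a b))"
proof -
  obtain \<alpha> :: "nat \<Rightarrow> nat \<Rightarrow> complex" where \<alpha>0: "\<And>x. \<alpha> 0 x = a $ of_nat x" and
    \<alpha>: "\<And>x y. x < 2 \<Longrightarrow> y < 2 \<Longrightarrow> (\<Sum>m<2. \<alpha> m x * cnj (\<alpha> m y)) = (if x = y then 1 else 0)"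
    using qubit_basis[OF assms(1)] by blast
  obtain \<beta> :: "nat \<Rightarrow> nat \<Rightarrow> complex" where \<beta>0: "\<And>x. \<beta> 0 x = b $ of_nat x" and
    \<beta>: "\<And>x y. x < 2 \<Longrightarrow> y < 2 \<Longrightarrow> (\<Sum>m<2. \<beta> m x * cnj (\<beta> m y)) = (if x = y then 1 else 0)"
    using qubit_basis[OF assms(2)] by blast
  define k where "k m m' = (if m = (0::nat) \<and> m' = (0::nat) then j else 0)" for m m'
  \<comment> \<open>The Kraus operators are bras, so a measured system becomes one-dimensional;
    hence the dimension 1 in the pullbacks and in \<open>locc 1 2\<close>.\<close>
  define N where "N m = (\<lambda>i x y. \<Sum>m'<(2::nat). \<Sum>r<(1::nat). pull_snd 1 (\<lambda>l x. cnj (\<beta> m' x))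
    (\<lambda>x y. if i = k m m' \<and> x = y then 1 else 0) x y)" for m
  define E where "E = (\<lambda>i x y. \<Sum>m<(2::nat). \<Sum>r<(1::nat). pull_fst 1 (\<lambda>l x. cnj (\<alpha> m x)) (N m i) x y)"
  have "locc 1 2 (N m)" for m
    unfolding N_def
    by (rule second_party[where d' = "\<lambda>_. 1" and s = "\<lambda>_. 1" and K = "\<lambda>m r l x. cnj (\<beta> m x)"])
      (use \<beta> in \<open>auto simp: instrument_def intro: locc.stop\<close>)
  then have "locc 2 2 E"
    unfolding E_def
    by (intro first_party[where d' = "\<lambda>_. 1" and s = "\<lambda>_. 1" and K = "\<lambda>m r l x. cnj (\<alpha> m x)"])
      (use \<alpha> in \<open>auto simp: instrument_def\<close>)
  moreover have "proj_effects j (tens a b) i $ (of_nat x, of_nat y) $ (of_nat x', of_nat y') = E i (x, y) (x', y')"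
    if lt: "x < 2" "y < 2" "x' < 2" "y' < 2" for i x y x' y'
  proof -
    have E: "E i (x, y) (x', y') = (\<Sum>m<2. \<Sum>m'<2. if i = k m m' then
        (\<alpha> m x * cnj (\<alpha> m x')) * (\<beta> m' y * cnj (\<beta> m' y')) else 0)"
      by (simp add: E_def N_def pull_fst_def pull_snd_def numeral_2_eq_2 algebra_simps)
    \<comment> \<open>The four product projections sum to the identity, so the three assigned to
      outcome 0 give the complement.\<close>
    have one: "(\<Sum>m<2. \<Sum>m'<2. (\<alpha> m x * cnj (\<alpha> m x')) * (\<beta> m' y * cnj (\<beta> m' y')))
        = (mat 1 :: two_qubit_op) $ (of_nat x, of_nat y) $ (of_nat x', of_nat y')"
      using lt by (subst sum_product[symmetric]) (auto simp: \<alpha> \<beta> mat_def less_2_cases_iff)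
    have P: "outer (tens a b) $ (of_nat x, of_nat y) $ (of_nat x', of_nat y')
        = (\<alpha> 0 x * cnj (\<alpha> 0 x')) * (\<beta> 0 y * cnj (\<beta> 0 y'))"
      by (simp add: outer_def tens_def \<alpha>0 \<beta>0 mult_ac)
    consider "i = j" "i \<noteq> 0" | "i = 0" "i \<noteq> j" | "i \<noteq> 0" "i \<noteq> j" using assms(3) by force
    then show ?thesis
    proof cases
      case 1
      then show ?thesis unfolding E proj_effects_def by (simp add: P k_def numeral_2_eq_2)
    next
      case 2
      then show ?thesis unfolding E proj_effects_def
        by (simp add: P one[symmetric] k_def numeral_2_eq_2)
    next
      case 3
      then show ?thesis unfolding E proj_effects_def by (simp add: k_def numeral_2_eq_2)
    qed
  qed
  moreover have "measurement n (proj_effects j (tens a b))"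
    using assms by (intro measurement_proj_effects) (simp_all add: norm_tens)
  ultimately show ?thesis unfolding locc_measurement_def by blast
qed

section \<open>Extremal ratios of quadratic forms\<close>

text \<open>Neither form changes when a kernel vector of \<open>R\<close> is added, so only the
  orthogonal complement matters. On its unit sphere the form of \<open>R\<close> is positive, and
  the ratio is continuous on a compact set.\<close>

lemma max_ratio_attained:
  fixes A R :: "complex^'n^'n"
  assumes A: "A \<in> psd" and R: "R \<in> psd" "R \<noteq> 0" and ker: "\<And>x. R *v x = 0 \<Longrightarrow> A *v x = 0"
  obtains c v where "norm v = 1" "0 < v \<bullet> (R *v v)" "v \<bullet> (A *v v) = c * (v \<bullet> (R *v v))"
    "\<And>x. x \<bullet> (A *v x) \<le> c * (x \<bullet> (R *v x))"
proof -
  define K where "K = {x. R *v x = 0}"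
  define S where "S = sphere 0 1 \<inter> (\<Inter>k\<in>K. {x. x \<bullet> k = 0})"
  have hA: "A \<in> hermitian" and hR: "R \<in> hermitian" using A R by (simp_all add: psd_iff)
  have K: "subspace K"
    unfolding K_def subspace_def by (simp add: matrix_vector_right_distrib mult_vec_scaleR)
  have "compact S"
    unfolding S_def by (intro compact_Int_closed compact_sphere closed_INT ballI closed_Collect_eq continuous_intros)
  have pos: "0 < x \<bullet> (R *v x)" if "x \<in> S" for x
  proof (rule ccontr)
    assume "\<not> 0 < x \<bullet> (R *v x)"
    moreover have "0 \<le> x \<bullet> (R *v x)" using R(1) by (simp add: psd_iff)
    ultimately have "x \<in> K" using psd_kernel[OF R(1), of x] by (simp add: K_def)
    then show False using that by (auto simp: S_def)
  qed
  have decomp: "\<exists>y z. y \<in> K \<and> x = y + z \<and> (z = 0 \<or> z /\<^sub>R norm z \<in> S)" for x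
  proof -
    obtain y z where y: "y \<in> span K" and z: "\<And>w. w \<in> span K \<Longrightarrow> orthogonal z w" and x: "x = y + z"
      using orthogonal_subspace_decomp_exists[of K x] by blast
    have "span K = K" using K by (rule span_eq_iff[THEN iffD2])
    then have "y \<in> K" using y by (rule subst[of _ _ "\<lambda>K. y \<in> K"])
    moreover have "z /\<^sub>R norm z \<in> S" if "z \<noteq> 0"
    proof -
      have "z \<bullet> w = 0" if "w \<in> K" for w
        using z[OF span_base[OF that]] by (simp only: orthogonal_def)
      then show ?thesis using that by (simp add: S_def)
    qed
    ultimately show ?thesis using x by (intro exI[of _ y] exI[of _ z] conjI) blast+
  qed
  obtain x where "R *v x \<noteq> 0" using R(2) matrix_eq[of R 0] by auto
  then have "x \<notin> K" by (simp add: K_def)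
  then have "S \<noteq> {}" using decomp[of x] by auto
  then obtain v where v: "v \<in> S"
    and max: "\<And>x. x \<in> S \<Longrightarrow> x \<bullet> (A *v x) / (x \<bullet> (R *v x)) \<le> v \<bullet> (A *v v) / (v \<bullet> (R *v v))"
    using continuous_attains_sup[OF \<open>compact S\<close>, of "\<lambda>x. x \<bullet> (A *v x) / (x \<bullet> (R *v x))"] pos
    by (force intro!: continuous_intros)
  define c where "c = v \<bullet> (A *v v) / (v \<bullet> (R *v v))"
  have "x \<bullet> (A *v x) \<le> c * (x \<bullet> (R *v x))" for x
  proof -
    obtain y z where y: "y \<in> K" and x: "x = y + z" and z: "z = 0 \<or> z /\<^sub>R norm z \<in> S"
      using decomp by blast
    have Ry: "R *v y = 0" using y by (simp add: K_def)
    have eq: "x \<bullet> (A *v x) = z \<bullet> (A *v z)" "x \<bullet> (R *v x) = z \<bullet> (R *v z)"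
      using inner_kernel_add[OF hA ker[OF Ry], of z 1] inner_kernel_add[OF hR Ry, of z 1]
      by (simp_all add: x add.commute)
    show ?thesis
    proof (cases "z = 0")
      case False
      define u where "u = z /\<^sub>R norm z"
      have zu: "z = norm z *\<^sub>R u" using False by (simp add: u_def)
      have u: "u \<in> S" using False z by (simp add: u_def)
      then have "u \<bullet> (A *v u) \<le> c * (u \<bullet> (R *v u))"
        using max[OF u] pos[OF u] by (simp add: c_def pos_divide_le_eq)
      then have "(norm z)\<^sup>2 * (u \<bullet> (A *v u)) \<le> (norm z)\<^sup>2 * (c * (u \<bullet> (R *v u)))"
        by (intro mult_left_mono) simp_all
      then show ?thesis
        unfolding eq using inner_scaleR_mult_vec[of "norm z" u A] inner_scaleR_mult_vec[of "norm z" u R]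
        by (simp add: zu[symmetric] mult_ac)
    qed (simp add: eq)
  qed
  with that[of v c] v pos[OF v] show thesis by (auto simp: c_def S_def)
qed

lemma continuous_on_tens [continuous_intros]:
  "continuous_on S f \<Longrightarrow> continuous_on S g \<Longrightarrow> continuous_on S (\<lambda>x. tens (f x) (g x))"
  unfolding tens_def by (intro continuous_intros)

lemma min_tens_attained:
  fixes W :: two_qubit_op
  obtains a b where "norm a = 1" "norm b = 1"
    "\<And>a' b'. norm a' = 1 \<Longrightarrow> norm b' = 1 \<Longrightarrow> tens a b \<bullet> (W *v tens a b) \<le> tens a' b' \<bullet> (W *v tens a' b')"
proof -
  have "\<exists>p\<in>sphere 0 1 \<times> sphere 0 1. \<forall>p'\<in>sphere 0 1 \<times> sphere 0 1.
      tens (fst p) (snd p) \<bullet> (W *v tens (fst p) (snd p)) \<le> tens (fst p') (snd p') \<bullet> (W *v tens (fst p') (snd p'))"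
    by (intro continuous_attains_inf compact_Times compact_sphere continuous_intros)
      (use vector_choose_size[of 1] in auto)
  then show thesis using that by (auto simp: Ball_def)
qed

section \<open>Confidence and witnesses\<close>

locale two_qubit_ensemble =
  fixes n j :: nat and \<eta> :: "nat \<Rightarrow> real" and \<rho> :: "nat \<Rightarrow> two_qubit_op"
  assumes ens: "ensemble n \<eta> \<rho>" and j: "j \<in> {1..n}"
begin

abbreviation "R \<equiv> average_state n \<eta> \<rho>"

abbreviation "A \<equiv> \<eta> j *\<^sub>R \<rho> j"

abbreviation "W q \<equiv> q *\<^sub>R R - A"

lemma psd_component: "i \<in> {1..n} \<Longrightarrow> \<eta> i *\<^sub>R \<rho> i \<in> psd"
  using ens by (auto simp: ensemble_def states_def intro!: psd_scaleR less_imp_le)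

lemma psd_A: "A \<in> psd"
  using j by (rule psd_component)

lemma psd_R: "R \<in> psd"
  unfolding average_state_def using psd_component by (rule psd_sum)

lemma psd_R_minus_A: "R - A \<in> psd"
proof -
  have eq: "R - A = (\<Sum>i\<in>{1..n}-{j}. \<eta> i *\<^sub>R \<rho> i)"
    using j by (simp add: average_state_def sum.remove[of _ j])
  show ?thesis unfolding eq by (intro psd_sum psd_component) blast
qed

lemma trace_R: "trace R = 1"
proof -
  have "trace (\<Sum>i\<in>I. \<eta> i *\<^sub>R \<rho> i) = (\<Sum>i\<in>I. \<eta> i *\<^sub>R 1)" if "I \<subseteq> {1..n}" "finite I" for I
    using that(2,1)
    by (induction I)
      (use ens in \<open>auto simp: trace_add trace_scaleR ensemble_def states_def trace_def[of 0]\<close>)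
  from this[of "{1..n}"] show ?thesis
    using ens by (simp add: average_state_def ensemble_def flip: scaleR_sum_left)
qed

lemma R_nonneg: "0 \<le> x \<bullet> (R *v x)" and A_nonneg: "0 \<le> x \<bullet> (A *v x)"
  using psd_R psd_A by (simp_all add: psd_iff)

lemma A_le_R: "x \<bullet> (A *v x) \<le> x \<bullet> (R *v x)"
  using psd_R_minus_A by (simp add: psd_iff matrix_vector_mult_diff_rdistrib inner_diff_right)

text \<open>The form of \<open>A\<close> lies between 0 and that of \<open>R\<close>, so it vanishes
  on the kernel of \<open>R\<close>.\<close>

lemma A_kernel: "R *v x = 0 \<Longrightarrow> A *v x = 0"
  using A_le_R[of x] A_nonneg[of x] by (intro psd_kernel psd_A) simp

lemma W_kernel: "R *v x = 0 \<Longrightarrow> W q *v x = 0"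
  using A_kernel[of x] by (simp add: matrix_vector_mult_diff_rdistrib scaleR_mult_vec)

lemma W_hermitian: "W q \<in> hermitian"
  by (intro subspace_diff subspace_scale subspace_hermitian psd_hermitian psd_R psd_A)

lemma inner_W: "x \<bullet> (W q *v x) = q * (x \<bullet> (R *v x)) - x \<bullet> (A *v x)"
  by (simp add: matrix_vector_mult_diff_rdistrib scaleR_mult_vec inner_diff_right)

lemma W_psd_iff: "W q \<in> psd \<longleftrightarrow> (\<forall>x. x \<bullet> (A *v x) \<le> q * (x \<bullet> (R *v x)))"
  by (simp add: psd_iff W_hermitian inner_W)

lemma W_block_positive_iff:
  "W q \<in> block_positive \<longleftrightarrow> (\<forall>a b. tens a b \<bullet> (A *v tens a b) \<le> q * (tens a b \<bullet> (R *v tens a b)))"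
  by (simp add: block_positive_iff W_hermitian inner_W)

lemma trace_R_mult_pos:
  assumes "B \<in> psd" "trace (R ** B) \<noteq> 0"
  shows "0 < Re (trace (R ** B))"
  using trace_mult_psd[OF psd_R assms(1)] assms(2) by (auto simp: complex_eq_iff less_le)

section \<open>Confidence and positivity of \<open>W q\<close>\<close>

lemma confidence_proj_effects:
  "confidence n \<eta> \<rho> j (proj_effects j v) = v \<bullet> (A *v v) / (v \<bullet> (R *v v))"
proof -
  have "\<rho> j \<in> hermitian" using ens j by (auto simp: ensemble_def states_def psd_iff)
  then show ?thesis
    by (simp add: confidence_def proj_effects_def trace_outer psd_hermitian[OF psd_R] scaleR_mult_vec)
qed

lemma trace_R_proj_effects: "trace (R ** proj_effects j v j) = of_real (v \<bullet> (R *v v))"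
  by (simp add: proj_effects_def trace_outer psd_hermitian[OF psd_R])

text \<open>Nonnegativity of the trace of \<open>M j ** W q\<close> is the claimed bound after
  division by the positive probability of outcome \<open>j\<close>.\<close>

lemma confidence_le:
  assumes "W q \<in> psd" "measurement n M" "trace (R ** M j) \<noteq> 0"
  shows "confidence n \<eta> \<rho> j M \<le> q"
proof -
  have M: "M j \<in> psd" using assms(2) j by (simp add: measurement_def)
  have "0 \<le> Re (trace (M j ** W q))"
    using trace_mult_psd(1)[OF M assms(1)] .
  also have "trace (M j ** W q) = q *\<^sub>R trace (M j ** R) - \<eta> j *\<^sub>R trace (M j ** \<rho> j)"
    by (simp add: matrix_diff_ldistrib trace_sub trace_mult_scaleR)
  finally have "\<eta> j * Re (trace (\<rho> j ** M j)) \<le> q * Re (trace (R ** M j))"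
    by (simp add: trace_mul_sym[of "M j"])
  then show ?thesis
    using trace_R_mult_pos[OF M assms(3)] by (simp add: confidence_def pos_divide_le_eq)
qed

lemma W_psd_iff_max_confidence: "W q \<in> psd \<longleftrightarrow> max_confidence n \<eta> \<rho> j \<le> q"
proof -
  have "R \<noteq> 0" using trace_R by (auto simp: trace_def)
  then obtain c v where v: "norm v = 1" "0 < v \<bullet> (R *v v)" "v \<bullet> (A *v v) = c * (v \<bullet> (R *v v))"
    and c: "\<And>x. x \<bullet> (A *v x) \<le> c * (x \<bullet> (R *v x))"
    using max_ratio_attained[OF psd_A psd_R _ A_kernel] by metis
  have "W c \<in> psd" using c by (simp add: W_psd_iff)
  have "max_confidence n \<eta> \<rho> j = c"
    unfolding max_confidence_def
  proof (rule Greatest_equality)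
    \<comment> \<open>The projective measurement onto the maximising vector has the optimal ratio as
      its confidence.\<close>
    show "\<exists>M. measurement n M \<and> trace (R ** M j) \<noteq> 0 \<and> c = confidence n \<eta> \<rho> j M"
      using v j by (intro exI[of _ "proj_effects j v"])
        (simp add: measurement_proj_effects confidence_proj_effects trace_R_proj_effects)
  qed (use confidence_le[OF \<open>W c \<in> psd\<close>] in auto)
  moreover have "W q \<in> psd \<longleftrightarrow> c \<le> q"
  proof
    assume "W q \<in> psd"
    then have "v \<bullet> (A *v v) \<le> q * (v \<bullet> (R *v v))" by (simp add: W_psd_iff)
    then show "c \<le> q" using v by simp
  next
    assume "c \<le> q"
    then have "c * (x \<bullet> (R *v x)) \<le> q * (x \<bullet> (R *v x))" for x
      by (intro mult_right_mono R_nonneg)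
    then show "W q \<in> psd" using c by (auto simp: W_psd_iff intro: order_trans)
  qed
  ultimately show ?thesis by simp
qed

section \<open>The least value at which \<open>W q\<close> is block positive\<close>

lemma product_in_support:
  obtains a b where "norm a = 1" "norm b = 1" "0 < tens a b \<bullet> (R *v tens a b)"
proof -
  \<comment> \<open>Trace one forces a nonzero diagonal entry, which is the value of the form at a
    product basis vector.\<close>
  have "\<exists>x. Re (R $ x $ x) \<noteq> 0"
  proof (rule ccontr)
    assume "\<nexists>x. Re (R $ x $ x) \<noteq> 0"
    then have "Re (trace R) = 0" by (simp add: trace_def del: split_paired_All split_paired_Ex)
    then show False by (simp add: trace_R)
  qed
  then obtain x where x: "Re (R $ x $ x) \<noteq> 0" ..
  have "tens (axis (fst x) 1) (axis (snd x) 1) = axis x (1::complex)"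
    by (auto simp: tens_def axis_def vec_eq_iff prod_eq_iff)
  then have "0 < tens (axis (fst x) 1) (axis (snd x) 1) \<bullet> (R *v tens (axis (fst x) 1) (axis (snd x) 1))"
    using R_nonneg[of "axis x 1"] x inner_axis_mult_vec[of x R] by simp
  then show thesis using that[of "axis (fst x) 1" "axis (snd x) 1"] by simp
qed

text \<open>The admissible \<open>q\<close> form an intersection of closed conditions, containing 1
  and bounded below by 0, so a least one exists. Nonnegativity of \<open>R\<close> makes the set
  upward closed.\<close>

lemma W_block_positive_iff_witness_bound: "W q \<in> block_positive \<longleftrightarrow> witness_bound n \<eta> \<rho> j \<le> q"
proof -
  define S where "S = {q. W q \<in> block_positive}"
  obtain a b where ab: "0 < tens a b \<bullet> (R *v tens a b)" using product_in_support by blast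
  have "S = (\<Inter>a. \<Inter>b. {q. tens a b \<bullet> (A *v tens a b) \<le> q * (tens a b \<bullet> (R *v tens a b))})"
    by (auto simp: S_def W_block_positive_iff)
  then have "closed S"
    by (auto intro!: closed_INT closed_Collect_le continuous_intros)
  have ge0: "0 \<le> q" if "q \<in> S" for q
  proof -
    have "0 \<le> q * (tens a b \<bullet> (R *v tens a b))"
      using that A_nonneg[of "tens a b"] by (auto simp: S_def W_block_positive_iff intro: order_trans)
    then show ?thesis using ab by (simp add: zero_le_mult_iff)
  qed
  have bdd: "bdd_below S" using ge0 by (rule bdd_belowI)
  have "1 \<in> S" using A_le_R by (simp add: S_def W_block_positive_iff)
  then have Inf: "Inf S \<in> S" using closed_contains_Inf[OF _ bdd \<open>closed S\<close>] by blast
  have "witness_bound n \<eta> \<rho> j = Inf S"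
    unfolding witness_bound_def
    by (rule Least_equality) (use Inf cInf_lower[OF _ bdd] in \<open>auto simp: S_def\<close>)
  moreover have "q \<in> S \<longleftrightarrow> Inf S \<le> q"
  proof
    assume "Inf S \<le> q"
    then have "Inf S * (x \<bullet> (R *v x)) \<le> q * (x \<bullet> (R *v x))" for x
      by (intro mult_right_mono R_nonneg)
    then show "q \<in> S" using Inf unfolding S_def W_block_positive_iff mem_Collect_eq
      by (blast intro: order_trans)
  qed (rule cInf_lower[OF _ bdd])
  ultimately show ?thesis by (simp add: S_def)
qed

text \<open>If the minimum \<delta> of the form over unit product vectors were positive,
  \<open>q\<close> could be lowered by \<delta> divided by an upper bound for \<open>R\<close>,
  against minimality.\<close>

lemma separable_null_state:
  assumes q_def: "q = witness_bound n \<eta> \<rho> j"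
  shows "\<exists>\<sigma>\<in>separable_states. trace (\<sigma> ** W q) = 0"
proof -
  have bp: "W q \<in> block_positive" using W_block_positive_iff_witness_bound[of q] q_def by simp
  obtain a b where ab: "norm a = 1" "norm b = 1"
    and min: "\<And>a' b'. norm a' = 1 \<Longrightarrow> norm b' = 1 \<Longrightarrow> tens a b \<bullet> (W q *v tens a b) \<le> tens a' b' \<bullet> (W q *v tens a' b')"
    using min_tens_attained[of "W q"] by blast
  \<comment> \<open>A minimiser for \<open>- R\<close> maximises the form of \<open>R\<close>;
    adding 1 to that maximum then gives a positive bound \<open>B\<close>.\<close>
  obtain c d where max: "\<And>a' b'. norm a' = 1 \<Longrightarrow> norm b' = 1 \<Longrightarrow>
      tens c d \<bullet> (- R *v tens c d) \<le> tens a' b' \<bullet> (- R *v tens a' b')"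
    by (rule min_tens_attained[of "- R"]) (rule that)
  define \<delta> where "\<delta> = tens a b \<bullet> (W q *v tens a b)"
  define B where "B = tens c d \<bullet> (R *v tens c d) + 1"
  have B: "tens a' b' \<bullet> (R *v tens a' b') \<le> B" if "norm a' = 1" "norm b' = 1" for a' b'
    using max[OF that] matrix_vector_mult_diff_rdistrib[of 0 R] by (simp add: B_def)
  have "B > 0" using R_nonneg[of "tens c d"] by (simp add: B_def)
  have "\<delta> \<ge> 0" using bp by (simp add: block_positive_iff \<delta>_def)
  have "\<delta> = 0"
  proof (rule ccontr)
    assume "\<delta> \<noteq> 0"
    then have "\<delta> > 0" using \<open>\<delta> \<ge> 0\<close> by simp
    have "0 \<le> tens a' b' \<bullet> (W (q - \<delta> / B) *v tens a' b')" for a' b'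
    proof (rule inner_tens_nonneg_if_unit)
      fix a' b' :: "complex^2"
      assume unit: "norm a' = 1" "norm b' = 1"
      have "\<delta> / B * (tens a' b' \<bullet> (R *v tens a' b')) \<le> \<delta> / B * B"
        using B[OF unit] \<open>\<delta> > 0\<close> \<open>B > 0\<close> by (intro mult_left_mono) simp_all
      also have "\<dots> \<le> tens a' b' \<bullet> (W q *v tens a' b')"
        using min[OF unit] \<open>B > 0\<close> by (simp add: \<delta>_def)
      finally show "0 \<le> tens a' b' \<bullet> (W (q - \<delta> / B) *v tens a' b')"
        by (simp add: inner_W left_diff_distrib)
    qed
    then have "W (q - \<delta> / B) \<in> block_positive" by (simp add: block_positive_iff W_hermitian)
    then have "q \<le> q - \<delta> / B" unfolding W_block_positive_iff_witness_bound q_def .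
    then show False using \<open>\<delta> > 0\<close> \<open>B > 0\<close> by (simp add: field_simps)
  qed
  have "outer (tens a b) \<in> separable_states"
    using outer_tens_SEP[OF ab] outer_state[of "tens a b"] ab
    by (simp add: separable_states_def states_def norm_tens)
  moreover have "trace (outer (tens a b) ** W q) = 0"
    using \<open>\<delta> = 0\<close> trace_outer[OF W_hermitian[of q], of "tens a b"]
    by (simp add: \<delta>_def trace_mul_sym[of "outer (tens a b)"])
  ultimately show ?thesis by blast
qed

section \<open>Weakly optimal witnesses and the local confidence\<close>

lemma witness_bound_less_iff:
  "witness_bound n \<eta> \<rho> j = q \<and> q < max_confidence n \<eta> \<rho> j \<longleftrightarrow> weakly_optimal_witness (W q)"
proof
  assume q: "witness_bound n \<eta> \<rho> j = q \<and> q < max_confidence n \<eta> \<rho> j"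
  then show "weakly_optimal_witness (W q)"
    using separable_null_state[of q] W_psd_iff_max_confidence[of q] W_block_positive_iff_witness_bound[of q]
    by (auto simp: weakly_optimal_witness_def entanglement_witness_def)
next
  assume "weakly_optimal_witness (W q)"
  then obtain \<sigma> where bp: "W q \<in> block_positive" and npsd: "W q \<notin> psd"
    and \<sigma>: "\<sigma> \<in> separable_states" "trace (\<sigma> ** W q) = 0"
    by (auto simp: weakly_optimal_witness_def entanglement_witness_def)
  define Q where "Q = witness_bound n \<eta> \<rho> j"
  have "Q \<le> q" using bp by (simp add: W_block_positive_iff_witness_bound Q_def)
  have "Q = q"
  proof (rule ccontr)
    assume "Q \<noteq> q"
    then have "Q < q" using \<open>Q \<le> q\<close> by simp
    have sep: "\<sigma> \<in> SEP" "\<sigma> \<in> psd" "\<sigma> \<noteq> 0" using \<sigma>(1) by (auto simp: separable_states_def SEP_def trace_def)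
    have bQ: "W Q \<in> block_positive" by (simp add: W_block_positive_iff_witness_bound Q_def)
    \<comment> \<open>Lowering \<open>q\<close> to \<open>Q\<close> subtracts a nonnegative amount
      from a zero trace, yet block positivity keeps the result nonnegative. So \<sigma> annihilates
      \<open>R\<close>, which is then singular.\<close>
    then have "0 \<le> Re (trace (W Q ** \<sigma>))" using sep(1) by (simp add: block_positive_def)
    also have "trace (W Q ** \<sigma>) = trace (\<sigma> ** W q) - (q - Q) *\<^sub>R trace (\<sigma> ** R)"
      by (simp add: trace_mul_sym[of _ \<sigma>] matrix_diff_ldistrib trace_sub trace_mult_scaleR algebra_simps)
    finally have "(q - Q) * Re (trace (\<sigma> ** R)) \<le> 0" using \<sigma>(2) by simp
    then have "Re (trace (\<sigma> ** R)) \<le> 0" using \<open>Q < q\<close> by (simp add: mult_le_0_iff)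
    then have "trace (R ** \<sigma>) = 0"
      using trace_mult_psd[OF psd_R sep(2)] by (simp add: trace_mul_sym[of \<sigma>] complex_eq_iff)
    then obtain k where "k \<noteq> 0" "R *v k = 0"
      using trace_mult_psd_eq_0[OF psd_R sep(2)] sep(3) by blast
    then show False using block_positive_singular_psd[OF bp W_kernel] npsd by blast
  qed
  then show "witness_bound n \<eta> \<rho> j = q \<and> q < max_confidence n \<eta> \<rho> j"
    using npsd by (simp add: Q_def W_psd_iff_max_confidence)
qed

lemma locc_confidence_eq_if_singular:
  assumes "R *v k = 0" "k \<noteq> 0"
  shows "locc_confidence n \<eta> \<rho> j = max_confidence n \<eta> \<rho> j"
proof -
  define S where "S = {confidence n \<eta> \<rho> j M | M. locc_measurement n M \<and> trace (R ** M j) \<noteq> 0}"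
  define C where "C = max_confidence n \<eta> \<rho> j"
  have "W C \<in> psd" by (simp add: W_psd_iff_max_confidence C_def)
  then have le: "s \<le> C" if "s \<in> S" for s
    using that confidence_le by (auto simp: S_def locc_measurement_def)
  then have bdd: "bdd_above S" by (rule bdd_aboveI)
  \<comment> \<open>Local projective measurements already realise the ratio at every unit product
    vector outside the kernel of \<open>R\<close>, so \<open>Sup S\<close> bounds all these
    ratios.\<close>
  have mem: "tens a b \<bullet> (A *v tens a b) / (tens a b \<bullet> (R *v tens a b)) \<in> S"
    if "norm a = 1" "norm b = 1" "0 < tens a b \<bullet> (R *v tens a b)" for a b
    using that j locc_measurement_proj_effects[of a b j n] unfolding S_def
    by (intro CollectI exI[of _ "proj_effects j (tens a b)"])
      (simp add: confidence_proj_effects trace_R_proj_effects)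
  have "0 \<le> tens a b \<bullet> (W (Sup S) *v tens a b)" for a b
  proof (rule inner_tens_nonneg_if_unit)
    fix a b :: "complex^2"
    assume unit: "norm a = 1" "norm b = 1"
    show "0 \<le> tens a b \<bullet> (W (Sup S) *v tens a b)"
    proof (cases "tens a b \<bullet> (R *v tens a b) = 0")
      \<comment> \<open>No ratio is available here, but the product vector lies in the kernel of
        \<open>R\<close> and hence of \<open>W (Sup S)\<close>.\<close>
      case True
      then show ?thesis using psd_kernel[OF psd_R] W_kernel by (metis inner_zero_right order_refl)
    next
      case False
      then have pos: "0 < tens a b \<bullet> (R *v tens a b)" using R_nonneg[of "tens a b"] by simp
      show ?thesis
        using cSup_upper[OF mem[OF unit pos] bdd] pos by (simp add: inner_W pos_divide_le_eq)
    qed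
  qed
  then have "W (Sup S) \<in> block_positive" by (simp add: block_positive_iff W_hermitian)
  then have "C \<le> Sup S"
    using block_positive_singular_psd W_kernel[OF assms(1)] assms(2)
    by (auto simp: C_def simp flip: W_psd_iff_max_confidence)
  moreover have "S \<noteq> {}" using mem product_in_support by blast
  then have "Sup S \<le> C" using le by (rule cSup_least)
  ultimately show ?thesis by (simp add: locc_confidence_def S_def C_def)
qed

end

theorem corollary1:
  fixes n j :: nat and \<eta> :: "nat \<Rightarrow> real" and \<rho> :: "nat \<Rightarrow> two_qubit_op" and q :: real
  assumes "ensemble n \<eta> \<rho>" and "j \<in> {1..n}"
  shows "((witness_bound n \<eta> \<rho> j = q \<and> q < max_confidence n \<eta> \<rho> j) \<longleftrightarrow>
      weakly_optimal_witness (q *\<^sub>R average_state n \<eta> \<rho> - \<eta> j *\<^sub>R \<rho> j)) \<and>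
    (rank (average_state n \<eta> \<rho>) \<noteq> CARD(2 \<times> 2) \<longrightarrow>
      locc_confidence n \<eta> \<rho> j = max_confidence n \<eta> \<rho> j)"
proof -
  interpret two_qubit_ensemble n j \<eta> \<rho> using assms by unfold_locales
  have "locc_confidence n \<eta> \<rho> j = max_confidence n \<eta> \<rho> j" if rank: "rank R \<noteq> CARD(2 \<times> 2)"
  proof -
    obtain k where "k \<noteq> 0" "R *v k = 0" using kernel_if_rank_deficient[OF rank] by blast
    then show ?thesis by (intro locc_confidence_eq_if_singular)
  qed
  then show ?thesis using witness_bound_less_iff by blast
qed

end
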